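(* Let $D$ be a strong balanced bipartite digraph on $2a$ vertices ($a\ge 1$). Suppose that $d(x)+d(y)\ge 3a$ for every dominating pair of vertices $\{x,y\}$ and for every dominated pair of vertices $\{x,y\}$ in $D$. Then $D$ contains a cycle factor.
   Context: Digraphs are finite, without loops and without multiple arcs (both arcs $xy$ and $yx$ may be present). Write $x\rightarrow y$ if there is an arc from $x$ to $y$. A digraph is bipartite if its vertex set is a disjoint union of two independent sets $V_1,V_2$ (the partite sets), and balanced if $|V_1|=|V_2|$. It is strong if for every two vertices $x,y$ there is a directed path from $x$ to $y$. A pair $\{x,y\}$ of distinct vertices is dominating if there is a vertex $z$ with $x\rightarrow z$ and $y\rightarrow z$; it is dominated if there is a vertex $z$ with $z\rightarrow x$ and $z\rightarrow y$. The degree of a vertex $v$ is $d(v)=d^+(v)+d^-(v)$, the sum of its out-degree and in-degree in $D$. A cycle factor of $D$ is a collection of pairwise vertex-disjoint directed cycles $C_1,\dots,C_t$ of $D$ with $V(C_1)\cup\dots\cup V(C_t)=V(D)$; directed cycles of length $2$ are allowed. *)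

theory Defs
  imports "Graph_Theory.Graph_Theory"
begin

definition independent_in :: "('a,'b) pre_digraph \<Rightarrow> 'a set \<Rightarrow> bool" where
  "independent_in G S \<longleftrightarrow> S \<subseteq> verts G \<and> (\<forall>x\<in>S. \<forall>y\<in>S. \<not> x \<rightarrow>\<^bsub>G\<^esub> y)"

definition bipartition :: "('a,'b) pre_digraph \<Rightarrow> 'a set \<Rightarrow> 'a set \<Rightarrow> bool" where
  "bipartition G V\<^sub>1 V\<^sub>2 \<longleftrightarrow>
     verts G = V\<^sub>1 \<union> V\<^sub>2 \<and> V\<^sub>1 \<inter> V\<^sub>2 = {} \<and> independent_in G V\<^sub>1 \<and> independent_in G V\<^sub>2"

definition balanced_bipartite :: "('a,'b) pre_digraph \<Rightarrow> bool" where
  "balanced_bipartite G \<longleftrightarrow> (\<exists>V\<^sub>1 V\<^sub>2. bipartition G V\<^sub>1 V\<^sub>2 \<and> card V\<^sub>1 = card V\<^sub>2)"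

definition dominating_pair :: "('a,'b) pre_digraph \<Rightarrow> 'a \<Rightarrow> 'a \<Rightarrow> bool" where
  "dominating_pair G x y \<longleftrightarrow> x \<noteq> y \<and> (\<exists>z. x \<rightarrow>\<^bsub>G\<^esub> z \<and> y \<rightarrow>\<^bsub>G\<^esub> z)"

definition dominated_pair :: "('a,'b) pre_digraph \<Rightarrow> 'a \<Rightarrow> 'a \<Rightarrow> bool" where
  "dominated_pair G x y \<longleftrightarrow> x \<noteq> y \<and> (\<exists>z. z \<rightarrow>\<^bsub>G\<^esub> x \<and> z \<rightarrow>\<^bsub>G\<^esub> y)"

definition degree :: "('a,'b) pre_digraph \<Rightarrow> 'a \<Rightarrow> nat" where
  "degree G v = out_degree G v + in_degree G v"

text \<open>
  The library represents a cycle by its list of arcs. Since every vertex of a cycle is the tail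
  of exactly one of its arcs, the tails make up its vertex set.
\<close>

definition cycle_verts :: "('a,'b) pre_digraph \<Rightarrow> 'b list \<Rightarrow> 'a set" where
  "cycle_verts G p = tail G ` set p"

text \<open>
  Two rotations of the same cycle are different arc lists, but they share vertices, so
  disjointness allows at most one of them in a cycle factor. In a loopfree digraph the library's
  cycles have length at least 2, and cycles of length 2 are allowed.
\<close>

definition cycle_factor :: "('a,'b) pre_digraph \<Rightarrow> 'b list set \<Rightarrow> bool" where
  "cycle_factor G \<C> \<longleftrightarrow>
     finite \<C> \<and>
     (\<forall>p\<in>\<C>. pre_digraph.cycle G p) \<and>
     (\<forall>p\<in>\<C>. \<forall>q\<in>\<C>. p \<noteq> q \<longrightarrow> cycle_verts G p \<inter> cycle_verts G q = {}) \<and>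
     (\<Union>p\<in>\<C>. cycle_verts G p) = verts G"

end

theory Submission
  imports Defs "HOL-Combinatorics.Orbits"
begin

text \<open>
  By Hall's theorem it is enough to match each partite set into the other along arcs: the two
  matchings together form a permutation of the vertices that moves each vertex along an arc, and
  its orbits are the required cycles. Suppose that a set \<open>S\<close> in one partite set has a smaller
  out-neighbourhood \<open>N\<close>. Since the digraph is strong, out-neighbours exist, so by the pigeonhole
  principle \<open>S\<close> contains a dominating pair, whose degrees sum to at most \<open>2a + 2|N|\<close>; hence
  \<open>2|N| \<ge> a\<close>. The vertices of the other partite set outside \<open>N\<close> have in-neighbours only among the
  \<open>a - |S|\<close> vertices outside \<open>S\<close>, and there are more than \<open>a - |S|\<close> of them, so some two of them
  form a dominated pair; hence \<open>2(a - |S|) \<ge> a\<close>. These inequalities contradict \<open>|N| < |S|\<close>.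
\<close>

section \<open>Hall's theorem\<close>

text \<open>Halmos-Vaughan induction on the size of \<open>A\<close>. If some nonempty proper subset
  \<open>S\<close> is tight, \<open>S\<close> and \<open>A - S\<close> can be matched separately.
  Otherwise every nonempty proper subset has a spare neighbour, so one pair can be fixed freely and
  removed.\<close>

lemma hall:
  assumes "finite A" "finite (R `` A)" "\<And>S. S \<subseteq> A \<Longrightarrow> card S \<le> card (R `` S)"
  shows "\<exists>f. inj_on f A \<and> (\<forall>x\<in>A. (x, f x) \<in> R)"
  using assms
proof (induction "card A" arbitrary: A R rule: less_induct)
  case less
  have fin: "finite (R `` S)" if "S \<subseteq> A" for S
    using that less.prems(2) by (meson Image_mono finite_subset order_refl)
  have finA: "finite S" if "S \<subseteq> A" for S
    using that less.prems(1) finite_subset by blast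
  consider "A = {}"
    | (tight) S where "S \<subset> A" "S \<noteq> {}" "card (R `` S) = card S"
    | (surplus) "A \<noteq> {}" "\<And>S. S \<subset> A \<Longrightarrow> S \<noteq> {} \<Longrightarrow> card S < card (R `` S)"
    using less.prems(3) by (metis le_neq_implies_less psubset_imp_subset)
  then show ?case
  proof cases
    case 1
    then show ?thesis by simp
  next
    case tight
    \<comment> \<open>Deleting all neighbours of \<open>S\<close> as targets keeps the values of
      \<open>g\<close> apart from those of \<open>f\<close>.\<close>
    define R' where "R' = R - UNIV \<times> (R `` S)"
    have "\<exists>f. inj_on f S \<and> (\<forall>x\<in>S. (x, f x) \<in> R)"
    proof (rule less.hyps)
      show "card S < card A" using less.prems(1) tight(1) by (rule psubset_card_mono)
    qed (use tight(1) fin finA less.prems(3) in auto)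
    then obtain f where f: "inj_on f S" "\<forall>x\<in>S. (x, f x) \<in> R" by blast
    have "\<exists>g. inj_on g (A - S) \<and> (\<forall>x\<in>A - S. (x, g x) \<in> R')"
    proof (rule less.hyps)
      show "card (A - S) < card A"
        using tight(1,2) less.prems(1) by (intro psubset_card_mono) auto
      show "finite (A - S)" using less.prems(1) by simp
      show "finite (R' `` (A - S))"
        by (rule finite_subset[OF _ less.prems(2)]) (auto simp: R'_def)
      fix T assume T: "T \<subseteq> A - S"
      \<comment> \<open>Hall's condition passes to \<open>R'\<close> by applying it to
        \<open>S \<union> T\<close>: by tightness, \<open>S\<close> accounts for exactly
        \<open>card S\<close> of the neighbours.\<close>
      have "card S + card T = card (S \<union> T)"
        using T tight(1) finA by (subst card_Un_disjoint) auto
      also have "\<dots> \<le> card (R `` (S \<union> T))"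
        using T tight(1) by (intro less.prems(3)) auto
      also have "R `` (S \<union> T) = R `` S \<union> R' `` T"
        by (auto simp: R'_def)
      also have "card \<dots> \<le> card (R `` S) + card (R' `` T)"
        by (rule card_Un_le)
      finally show "card T \<le> card (R' `` T)" using tight(3) by simp
    qed
    then obtain g where g: "inj_on g (A - S)" "\<forall>x\<in>A - S. (x, g x) \<in> R'" by blast
    define h where "h x = (if x \<in> S then f x else g x)" for x
    have "f x \<noteq> g y" if "x \<in> S" "y \<in> A - S" for x y
      using that f(2) g(2) unfolding R'_def by fastforce
    then have "inj_on h A"
      using f(1) g(1) by (auto simp: inj_on_def h_def) metis
    moreover have "\<forall>x\<in>A. (x, h x) \<in> R"
      using f(2) g(2) by (auto simp: h_def R'_def)
    ultimately show ?thesis by blast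
  next
    case surplus
    then obtain x where x: "x \<in> A" by blast
    then obtain y where y: "(x, y) \<in> R"
      using less.prems(3)[of "{x}"] by (cases "R `` {x} = {}") auto
    define R' where "R' = R - UNIV \<times> {y}"
    have "\<exists>g. inj_on g (A - {x}) \<and> (\<forall>z\<in>A - {x}. (z, g z) \<in> R')"
    proof (rule less.hyps)
      show "card (A - {x}) < card A"
        using x less.prems(1) by (rule card_Diff1_less[rotated])
      show "finite (A - {x})" using less.prems(1) by simp
      show "finite (R' `` (A - {x}))"
        by (rule finite_subset[OF _ less.prems(2)]) (auto simp: R'_def)
      fix T assume T: "T \<subseteq> A - {x}"
      show "card T \<le> card (R' `` T)"
      proof (cases "T = {}")
        case False
        \<comment> \<open>\<open>T\<close> misses \<open>x\<close>, hence is a proper subset of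
          \<open>A\<close>; its surplus of at least one pays for the loss of
          \<open>y\<close>.\<close>
        then have "card T < card (R `` T)"
          using T x by (intro surplus(2)) auto
        also have "\<dots> \<le> card (insert y (R' `` T))"
          using T by (intro card_mono finite.insertI finite_subset[OF _ fin[of T]])
            (auto simp: R'_def)
        also have "\<dots> \<le> Suc (card (R' `` T))" by (rule card_insert_le_m1) auto
        finally show ?thesis by simp
      qed simp
    qed
    then obtain g where g: "inj_on g (A - {x})" "\<forall>z\<in>A - {x}. (z, g z) \<in> R'" by blast
    have "inj_on (g(x := y)) A"
      using g by (fastforce simp: inj_on_def R'_def)
    moreover have "\<forall>z\<in>A. (z, (g(x := y)) z) \<in> R"
      using g(2) y by (auto simp: R'_def)
    ultimately show ?thesis by blast
  qed
qed

section \<open>Cycle factors from permutations\<close>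

text \<open>Here \<open>e\<close> picks an arc from \<open>u\<close> to \<open>f u\<close>. Both
  conditions are required only along the iterates of \<open>u\<close>, since in the application
  \<open>e\<close> is specified only on vertices of the digraph.\<close>

lemma (in wf_digraph) cas_funpow:
  assumes "\<And>i. tail G (e ((f ^^ i) u)) = (f ^^ i) u"
    and "\<And>i. head G (e ((f ^^ i) u)) = (f ^^ Suc i) u"
  shows "cas u (map (\<lambda>i. e ((f ^^ i) u)) [0..<n]) ((f ^^ n) u)"
proof (induction n)
  case (Suc n)
  then show ?case using assms by (simp add: awlast_if_cas)
qed simp

text \<open>The cycle follows the arcs from \<open>u\<close> to \<open>f u\<close>, starting at
  \<open>v\<close>, until the first return to \<open>v\<close>.\<close>

lemma (in fin_digraph) orbit_cycle:
  assumes f: "f permutes verts G" and arc: "\<And>v. v \<in> verts G \<Longrightarrow> v \<rightarrow>\<^bsub>G\<^esub> f v"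
    and v: "v \<in> verts G"
  shows "\<exists>p. cycle p \<and> cycle_verts G p = orbit f v"
proof -
  have "\<forall>u\<in>verts G. \<exists>d. d \<in> arcs G \<and> tail G d = u \<and> head G d = f u"
    using arc by (meson reachableE)
  then obtain e where e: "\<And>u. u \<in> verts G \<Longrightarrow> e u \<in> arcs G \<and> tail G (e u) = u \<and> head G (e u) = f u"
    by metis
  have vi: "(f ^^ i) v \<in> verts G" for i
    using v f by (induction i) (auto simp: permutes_in_image)
  \<comment> \<open>\<open>orbit f v\<close> is generated from \<open>f v\<close>, so this
    membership is a real return statement; it holds because \<open>f\<close> permutes a finite
    set.\<close>
  have self: "v \<in> orbit f v"
    by (rule permutation_self_in_orbit) (unfold permutation_permutes, use f finite_verts in blast)
  \<comment> \<open>The least positive number of steps leading from \<open>v\<close> back to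
    \<open>v\<close>.\<close>
  define n where "n = funpow_dist1 f v v"
  define p where "p = map (\<lambda>i. e ((f ^^ i) v)) [0..<n]"
  have n: "(f ^^ n) v = v" "n > 0"
    using funpow_dist1_prop[OF self] by (simp_all add: n_def)
  have cas: "cas v p v"
    using cas_funpow[of e f v n] e[OF vi] n(1) by (simp add: p_def)
  have "p \<noteq> []" using n(2) by (simp add: p_def)
  moreover have "awalk v p v"
    using cas v e[OF vi] by (auto simp: awalk_def p_def)
  moreover have "distinct (tl (awalk_verts v p))"
  proof -
    \<comment> \<open>Without its first entry, the vertex list of the walk consists of the heads of
      the arcs. These are the images under the injective \<open>f\<close> of the first
      \<open>n\<close> iterates, which are distinct by minimality of \<open>n\<close>.\<close>
    have "tl (awalk_verts v p) = map (\<lambda>i. f ((f ^^ i) v)) [0..<n]"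
      using e[OF vi] by (subst awalk_verts_conv'[OF cas]) (simp add: \<open>p \<noteq> []\<close>, simp add: p_def)
    also have "distinct \<dots>"
      using inj_on_funpow_dist1[OF self, folded n_def] permutes_inj[OF f]
      by (auto simp: distinct_map inj_on_def)
    finally show ?thesis .
  qed
  ultimately have "cycle p" unfolding cycle_def by blast
  moreover have "cycle_verts G p = orbit f v"
    using e[OF vi] orbit_conv_funpow_dist1[OF self, folded n_def]
    by (simp add: cycle_verts_def p_def image_image)
  ultimately show ?thesis by blast
qed

text \<open>The orbits partition the vertices. One cycle is chosen per orbit, not per vertex:
  different starting points on one orbit could yield different rotations, which would violate
  disjointness.\<close>

lemma (in fin_digraph) permutation_imp_cycle_factor:
  assumes f: "f permutes verts G" and arc: "\<And>v. v \<in> verts G \<Longrightarrow> v \<rightarrow>\<^bsub>G\<^esub> f v"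
  shows "\<exists>\<C>. cycle_factor G \<C>"
proof -
  have perm: "permutation f" unfolding permutation_permutes using f finite_verts by blast
  have "\<forall>Q\<in>orbit f ` verts G. \<exists>p. cycle p \<and> cycle_verts G p = Q"
    using orbit_cycle[OF assms] by blast
  then obtain c where c: "\<And>Q. Q \<in> orbit f ` verts G \<Longrightarrow> cycle (c Q) \<and> cycle_verts G (c Q) = Q"
    by metis
  \<comment> \<open>Both orbits are cyclic, so each equals the orbit of the common point
    \<open>w\<close>.\<close>
  have eq: "orbit f u = orbit f v" if "w \<in> orbit f u" "w \<in> orbit f v" for u v w
    using orbit_cyclic_eq3[OF cyclic_on_orbit'[OF perm] that(1)]
      orbit_cyclic_eq3[OF cyclic_on_orbit'[OF perm] that(2)] by simp
  have disj: "orbit f u \<inter> orbit f v = {}" if "c (orbit f u) \<noteq> c (orbit f v)" for u v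
  proof (rule ccontr)
    assume "orbit f u \<inter> orbit f v \<noteq> {}"
    then obtain w where "w \<in> orbit f u" "w \<in> orbit f v" by blast
    from eq[OF this] that show False by simp
  qed
  have "(\<Union>v\<in>verts G. orbit f v) = verts G"
    using permutes_orbit_subset[OF f] permutation_self_in_orbit[OF perm] by blast
  then have "cycle_factor G (c ` orbit f ` verts G)"
    unfolding cycle_factor_def using c disj by simp
  then show ?thesis by blast
qed

section \<open>The degree condition\<close>

text \<open>A choice of one image per element of \<open>S\<close> cannot be injective. Applied to
  the arc relation this produces a dominating pair, and applied to its converse a dominated
  pair.\<close>

lemma pigeonhole_relation:
  assumes "finite (R `` S)" "card (R `` S) < card S" "\<And>x. x \<in> S \<Longrightarrow> R `` {x} \<noteq> {}"
  obtains x y z where "x \<in> S" "y \<in> S" "x \<noteq> y" "(x, z) \<in> R" "(y, z) \<in> R"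
proof -
  have "\<forall>x\<in>S. \<exists>y. (x, y) \<in> R" using assms(3) by blast
  then obtain g where g: "\<And>x. x \<in> S \<Longrightarrow> (x, g x) \<in> R" by metis
  then have "card (g ` S) \<le> card (R `` S)" by (intro card_mono assms(1)) auto
  then have "\<not> inj_on g S" using assms(2) by (intro pigeonhole) simp
  then obtain x y where "x \<in> S" "y \<in> S" "x \<noteq> y" "g x = g y" unfolding inj_on_def by blast
  with g[of x] g[of y] show ?thesis by (intro that[of x y "g x"]) simp_all
qed

text \<open>The second vertex \<open>y\<close> makes the paths nontrivial: the first arc of a path
  to \<open>y\<close> leaves \<open>x\<close>, and the last arc of a path from \<open>y\<close>
  enters \<open>x\<close>.\<close>

lemma (in wf_digraph) strongly_connected_neighbours:
  assumes "strongly_connected G" "x \<in> verts G" "y \<in> verts G" "x \<noteq> y"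
  shows "\<exists>z. x \<rightarrow>\<^bsub>G\<^esub> z" "\<exists>z. z \<rightarrow>\<^bsub>G\<^esub> x"
proof -
  have "x \<rightarrow>\<^sup>* y" "y \<rightarrow>\<^sup>* x" using assms by auto
  show "\<exists>z. x \<rightarrow>\<^bsub>G\<^esub> z"
    using \<open>x \<rightarrow>\<^sup>* y\<close> assms(4) by (cases rule: converse_reachable_cases) auto
  show "\<exists>z. z \<rightarrow>\<^bsub>G\<^esub> x"
    using \<open>y \<rightarrow>\<^sup>* x\<close> assms(4) by (induction rule: reachable_induct) auto
qed

text \<open>Without parallel arcs, out-arcs at \<open>x\<close> are determined by their heads. This
  turns degrees into sizes of neighbourhoods, as they occur in Hall's condition.\<close>

lemma (in digraph) out_degree_card: "out_degree G x = card (arcs_ends G `` {x})"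
proof -
  have "arcs_ends G `` {x} = head G ` out_arcs G x"
    by (auto simp: arcs_ends_conv image_iff)
  moreover have "inj_on (head G) (out_arcs G x)"
    by (intro inj_onI no_multi_arcs) (auto simp: arc_to_ends_def)
  ultimately show ?thesis by (simp add: out_degree_def card_image)
qed

lemma (in digraph) in_degree_card: "in_degree G x = card ((arcs_ends G)\<inverse> `` {x})"
proof -
  have "(arcs_ends G)\<inverse> `` {x} = tail G ` in_arcs G x"
    by (auto simp: arcs_ends_conv image_iff)
  moreover have "inj_on (tail G) (in_arcs G x)"
    by (intro inj_onI no_multi_arcs) (auto simp: arc_to_ends_def)
  ultimately show ?thesis by (simp add: in_degree_def card_image)
qed

lemma bipartition_sym: "bipartition G U W \<Longrightarrow> bipartition G W U"
  by (auto simp: bipartition_def)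

lemma (in wf_digraph) bipartition_adj:
  assumes "bipartition G U W" "x \<rightarrow>\<^bsub>G\<^esub> y"
  shows "x \<in> U \<longleftrightarrow> y \<in> W"
  using assms adj_in_verts[OF assms(2)] unfolding bipartition_def independent_in_def by blast

text \<open>The partite sets enter as an ordered pair, so that exchanging them gives the matching in
  the other direction.\<close>

lemma (in digraph) matching_exists:
  assumes str: "strongly_connected G" and bip: "bipartition G U W"
    and card: "card U = a" "card W = a"
    and dominating: "\<And>x y. dominating_pair G x y \<Longrightarrow> 3 * a \<le> degree G x + degree G y"
    and dominated: "\<And>x y. dominated_pair G x y \<Longrightarrow> 3 * a \<le> degree G x + degree G y"
  shows "\<exists>f. inj_on f U \<and> (\<forall>x\<in>U. x \<rightarrow>\<^bsub>G\<^esub> f x)"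
proof (rule hall)
  let ?R = "arcs_ends G"
  have V: "verts G = U \<union> W" "U \<inter> W = {}" using bip by (auto simp: bipartition_def)
  then have fin: "finite U" "finite W" using finite_verts by auto
  then show "finite U" by simp
  have RU: "?R `` X \<subseteq> W" if "X \<subseteq> U" for X
    using that bipartition_adj[OF bip] by blast
  have RW: "?R\<inverse> `` X \<subseteq> U" if "X \<subseteq> W" for X
    using that bipartition_adj[OF bip] by blast
  have RU': "?R `` X \<subseteq> U" if "X \<subseteq> W" for X
    using that bipartition_adj[OF bipartition_sym[OF bip]] by blast
  have RW': "?R\<inverse> `` X \<subseteq> W" if "X \<subseteq> U" for X
    using that bipartition_adj[OF bipartition_sym[OF bip]] by blast
  show "finite (?R `` U)" using RU fin(2) finite_subset by blast
  fix S assume S: "S \<subseteq> U"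
  show "card S \<le> card (?R `` S)"
  proof (rule ccontr)
    assume "\<not> ?thesis"
    then have small: "card (?R `` S) < card S" by simp
    define T where "T = W - ?R `` S"
    have NS: "?R `` S \<subseteq> W" "finite (?R `` S)" using RU[OF S] fin(2) finite_subset by auto
    have cS: "card S \<le> a" using card_mono[OF fin(1) S] card(1) by simp
    have cT: "card T = a - card (?R `` S)"
      unfolding T_def using NS card(2) by (simp add: card_Diff_subset)
    \<comment> \<open>\<open>small\<close> forces \<open>S\<close> to be nonempty, hence
      \<open>a\<close> to be positive. The vertices \<open>u\<close> and \<open>w\<close> then serve
      as the second vertex, on the opposite side, in
      \<open>strongly_connected_neighbours\<close>.\<close>
    have "U \<noteq> {}" "W \<noteq> {}" using small cS card by auto
    then obtain u w where uw: "u \<in> U" "w \<in> W" by blast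
    have ex: "\<exists>z. x \<rightarrow>\<^bsub>G\<^esub> z" if "x \<in> U" for x
      using strongly_connected_neighbours(1)[OF str, of x w] that uw V by blast
    have ex': "\<exists>z. z \<rightarrow>\<^bsub>G\<^esub> x" if "x \<in> W" for x
      using strongly_connected_neighbours(2)[OF str, of x u] that uw V by blast
    have NT: "?R\<inverse> `` T \<subseteq> U - S" using RW[of T] by (auto simp: T_def)
    have cNT: "card (?R\<inverse> `` T) \<le> a - card S"
      using card_mono[OF _ NT] fin(1) S card(1) by (simp add: card_Diff_subset finite_subset)
    obtain x y z where xy: "x \<in> S" "y \<in> S" "x \<noteq> y" "x \<rightarrow>\<^bsub>G\<^esub> z" "y \<rightarrow>\<^bsub>G\<^esub> z"
      by (rule pigeonhole_relation[OF NS(2) small]) (use ex S in blast)+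
    \<comment> \<open>Out-neighbours of \<open>v\<close> are among those of \<open>S\<close>; its
      in-neighbours can fill at most all of \<open>W\<close>.\<close>
    have dS: "degree G v \<le> a + card (?R `` S)" if "v \<in> S" for v
    proof -
      have "card (?R `` {v}) \<le> card (?R `` S)" using that NS(2) by (intro card_mono) auto
      moreover have "card (?R\<inverse> `` {v}) \<le> a"
        unfolding card(2)[symmetric] using that S by (intro card_mono fin RW') auto
      ultimately show ?thesis by (simp add: degree_def out_degree_card in_degree_card)
    qed
    have "3 * a \<le> degree G x + degree G y"
      using xy by (intro dominating) (auto simp: dominating_pair_def)
    then have N_large: "a \<le> 2 * card (?R `` S)" using dS[OF xy(1)] dS[OF xy(2)] by linarith
    \<comment> \<open>The bound \<open>cS\<close> keeps \<open>small\<close> strict under truncated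
      subtraction from \<open>a\<close>.\<close>
    have few: "card (?R\<inverse> `` T) < card T" using cNT cT small cS by linarith
    have finT: "finite (?R\<inverse> `` T)" using NT fin(1) finite_subset by blast
    obtain x' y' z' where xy': "x' \<in> T" "y' \<in> T" "x' \<noteq> y'" "z' \<rightarrow>\<^bsub>G\<^esub> x'" "z' \<rightarrow>\<^bsub>G\<^esub> y'"
      by (rule pigeonhole_relation[OF finT few]) (use ex' T_def in blast)+
    have dT: "degree G v \<le> a + (a - card S)" if "v \<in> T" for v
    proof -
      have "card (?R\<inverse> `` {v}) \<le> card (?R\<inverse> `` T)"
        using that finT by (intro card_mono) auto
      moreover have "card (?R `` {v}) \<le> a"
        unfolding card(1)[symmetric] using that by (intro card_mono fin RU') (auto simp: T_def)
      ultimately show ?thesis using cNT by (simp add: degree_def out_degree_card in_degree_card)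
    qed
    have "3 * a \<le> degree G x' + degree G y'"
      using xy' by (intro dominated) (auto simp: dominated_pair_def)
    then have "a \<le> 2 * (a - card S)" using dT[OF xy'(1)] dT[OF xy'(2)] by linarith
    \<comment> \<open>Doubling \<open>small\<close> makes \<open>2 * card S\<close> exceed
      \<open>a\<close>, by \<open>N_large\<close>, while the preceding bound makes it at most
      \<open>a\<close>.\<close>
    with N_large small cS show False by linarith
  qed
qed

theorem proposition4p1:
  fixes D :: "('a,'b) pre_digraph" and a :: nat
  assumes "digraph D"
    and "strongly_connected D"
    and "balanced_bipartite D"
    and "a \<ge> 1"
    and "card (verts D) = 2 * a"
    and "\<And>x y. dominating_pair D x y \<Longrightarrow> degree D x + degree D y \<ge> 3 * a"
    and "\<And>x y. dominated_pair D x y \<Longrightarrow> degree D x + degree D y \<ge> 3 * a"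
  shows "\<exists>\<C>. cycle_factor D \<C>"
proof -
  interpret digraph D by fact
  obtain U W where bip: "bipartition D U W" and eq: "card U = card W"
    using assms(3) by (auto simp: balanced_bipartite_def)
  have V: "verts D = U \<union> W" "U \<inter> W = {}" using bip by (auto simp: bipartition_def)
  then have fin: "finite U" "finite W" using finite_verts by auto
  have card: "card U = a" "card W = a"
    using assms(5) eq V fin by (simp_all add: card_Un_disjoint)
  obtain f where f: "inj_on f U" "\<And>x. x \<in> U \<Longrightarrow> x \<rightarrow>\<^bsub>D\<^esub> f x"
    using matching_exists[OF assms(2) bip card assms(6,7)] by blast
  obtain g where g: "inj_on g W" "\<And>x. x \<in> W \<Longrightarrow> x \<rightarrow>\<^bsub>D\<^esub> g x"
    using matching_exists[OF assms(2) bipartition_sym[OF bip] card(2,1) assms(6,7)] by blast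
  \<comment> \<open>The identity branch is there because \<open>permutes\<close> requires every
    point outside the vertex set to be fixed.\<close>
  define h where "h x = (if x \<in> U then f x else if x \<in> W then g x else x)" for x
  have fW: "f x \<in> W" if "x \<in> U" for x
    using bipartition_adj[OF bip f(2)[OF that]] that by blast
  have gU: "g x \<in> U" if "x \<in> W" for x
    using bipartition_adj[OF bipartition_sym[OF bip] g(2)[OF that]] that by blast
  have "inj_on h (verts D)"
  proof (rule inj_onI)
    fix x y assume "x \<in> verts D" "y \<in> verts D" "h x = h y"
    then show "x = y"
      \<comment> \<open>Points from different partite sets cannot collide, as their images lie in
        different partite sets.\<close>
      using fW[of x] fW[of y] gU[of x] gU[of y] f(1) g(1) V
      by (auto simp: h_def inj_on_def split: if_splits)
  qed
  moreover have "h ` verts D \<subseteq> verts D" using fW gU V by (auto simp: h_def)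
  ultimately have "bij_betw h (verts D) (verts D)"
    by (simp add: bij_betw_def endo_inj_surj)
  then have "h permutes verts D"
    by (rule bij_imp_permutes) (use V in \<open>auto simp: h_def\<close>)
  then show ?thesis
    by (rule permutation_imp_cycle_factor) (use f g V in \<open>auto simp: h_def\<close>)
qed

end
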